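(* Let $r\ge 3$ be a fixed integer, let $\omega=\omega(n)$ be such that $1\ll \omega \ll \log n$, and let $p=p(n)$ satisfy \[ \frac{1}{n^{r-1+1/\omega}} \le p = O\!\left(\frac{(\log n)^{r-1}}{n^{r-1}}\right). \] Then there exists $\ell_0=\ell_0(n)$ with $1\ll \ell_0 = O(\log n)$ such that \[ \left(\frac{n}{\ell_0}\right)^{r-1+1/\ell_0} p =1, \] and then a.a.s. $\ell_{\max}=\Theta(\ell_0)$, where $\ell_{\max}$ is the maximal length of an ordered loose path in the random $r$-uniform hypergraph $H^{(r)}(n,p)$.
   Context: Let $r\ge 2$ be a fixed integer (constant). $H=H^{(r)}(n,p)$ is the random $r$-uniform hypergraph on the vertex set $[n]=\{1,\dots,n\}$ in which each $r$-element subset of $[n]$ is included as an edge independently with probability $p=p(n)\in[0,1]$. An ordered loose path of length $\ell$ in $H$ is an increasing sequence of vertices $v_1<v_2<\dots<v_{\ell(r-1)+1}$ in $[n]$ such that the $\ell$ sets $\{v_{(k-1)(r-1)+1},v_{(k-1)(r-1)+2},\dots,v_{k(r-1)+1}\}$, $k=1,\dots,\ell$, are all edges of $H$ (so every two consecutive edges intersect in a single vertex). $\ell_{\max}$ denotes the maximal length of an ordered loose path in $H$. All asymptotics are as $n\to\infty$ (and statements about $n$-dependent quantities are for all sufficiently large $n$); "a.a.s." means with probability tending to $1$ as $n\to\infty$. $A_n\ll B_n$ means $A_n/B_n\to0$ as $n\to\infty$. The quantity $\ell_0=\ell_0(n)$ is a positive real number, not necessarily an integer. "A.a.s. $\ell_{\max}=\Theta(\ell_0)$"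 means that there are constants $0<c\le C$ (not depending on $n$) such that a.a.s. $c\,\ell_0\le\ell_{\max}\le C\,\ell_0$. *)

theory Defs
  imports "HOL-Probability.Probability" "HOL-Library.Landau_Symbols"
begin

definition r_subsets :: "nat \<Rightarrow> nat \<Rightarrow> nat set set" where
  "r_subsets r n = {e. e \<subseteq> {1..n} \<and> card e = r}"

text \<open>A hypergraph on \<open>{1..n}\<close> is represented by its set of edges.\<close>

definition random_hypergraph :: "nat \<Rightarrow> nat \<Rightarrow> real \<Rightarrow> nat set set pmf" where
  "random_hypergraph r n p =
     map_pmf (\<lambda>f. {e \<in> r_subsets r n. f e})
       (Pi_pmf (r_subsets r n) False (\<lambda>_. bernoulli_pmf p))"

text \<open>Only the values of \<open>v\<close> on \<open>{1..l * (r - 1) + 1}\<close> matter.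
  A single vertex is a path of length \<open>0\<close>.\<close>

definition ordered_loose_path ::
    "nat \<Rightarrow> nat \<Rightarrow> nat set set \<Rightarrow> nat \<Rightarrow> (nat \<Rightarrow> nat) \<Rightarrow> bool" where
  "ordered_loose_path r n E l v \<longleftrightarrow>
     strict_mono_on {1..l * (r - 1) + 1} v \<and>
     v ` {1..l * (r - 1) + 1} \<subseteq> {1..n} \<and>
     (\<forall>k\<in>{1..l}. v ` {(k - 1) * (r - 1) + 1..k * (r - 1) + 1} \<in> E)"

text \<open>For \<open>r \<ge> 2\<close> and \<open>n \<ge> 1\<close> the set below is finite (lengths are less than \<open>n\<close>)
  and contains \<open>0\<close>, so that \<open>Max\<close> is a genuine maximum.\<close>

definition l_max :: "nat \<Rightarrow> nat \<Rightarrow> nat set set \<Rightarrow> nat" where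
  "l_max r n E = Max {l. \<exists>v. ordered_loose_path r n E l v}"

definition aas :: "(nat \<Rightarrow> 'a pmf) \<Rightarrow> (nat \<Rightarrow> 'a \<Rightarrow> bool) \<Rightarrow> bool" where
  "aas M P \<longleftrightarrow> (\<lambda>n. measure_pmf.prob (M n) {x. P n x}) \<longlonglongrightarrow> 1"

definition is_ell0 :: "nat \<Rightarrow> (nat \<Rightarrow> real) \<Rightarrow> (nat \<Rightarrow> real) \<Rightarrow> bool" where
  "is_ell0 r p l0 \<longleftrightarrow>
     (\<forall>\<^sub>F n in sequentially. l0 n > 0) \<and>
     (\<lambda>n. 1 / l0 n) \<longlonglongrightarrow> 0 \<and>
     l0 \<in> O(\<lambda>n. ln (real n)) \<and>
     (\<forall>\<^sub>F n in sequentially.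
        (real n / l0 n) powr (real r - 1 + 1 / l0 n) * p n = 1)"

end

theory Submission
  imports Defs "HOL-Real_Asymp.Real_Asymp"
begin

text \<open>The upper bound on the longest path is a first moment computation at length \<open>2 * l0\<close>.
  The lower bound is a second moment computation for layered paths: cut an initial part of the
  vertex set into \<open>m = l * (r - 1) + 1\<close> consecutive intervals of length \<open>N\<close> and only count the
  paths whose \<open>i\<close>-th vertex lies in the \<open>i\<close>-th interval. Monotonicity is then automatic, two such
  paths can share an edge only at the same position, and the relative variance is at most
  \<open>1 / N * (1 + 1 / (p * N ^ (r - 1))) ^ l\<close>. For \<open>l\<close> a small multiple of \<open>l0\<close>, the defining equation
  of \<open>l0\<close> gives \<open>1 / (p * N ^ (r - 1)) \<le> n powr (1 / l0)\<close>, so the power is at most \<open>sqrt n\<close>,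
  whereas \<open>N \<ge> n / l0\<close>.\<close>

section \<open>Blocks of positions and the edges of a loose path\<close>

text \<open>These are positions along a path, not vertices: the \<open>k\<close>-th edge of
  \<open>v\<close> is \<open>v\<close> applied to \<open>block (r - 1) k\<close>. Questions about
  overlapping edges thus become questions about index intervals that do not depend on the
  path.\<close>

definition block :: "nat \<Rightarrow> nat \<Rightarrow> nat set" where
  "block s k = {(k - 1) * s + 1..k * s + 1}"

lemma finite_block [simp]: "finite (block s k)"
  by (simp add: block_def)

lemma card_block: "k \<ge> 1 \<Longrightarrow> card (block s k) = s + 1"
  by (cases k) (auto simp: block_def)

lemma block_subset: "k \<in> {1..l} \<Longrightarrow> block s k \<subseteq> {1..l * s + 1}"
  by (auto simp: block_def intro: order_trans mult_le_mono1)

lemma inj_on_block: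
  assumes "s \<ge> 1"
  shows "inj_on (block s) {1..}"
proof (rule inj_onI)
  fix j k :: nat assume *: "block s j = block s k"
  \<comment> \<open>A block is recovered from its largest element, since \<open>s\<close> is
    positive.\<close>
  have "Max (block s i) = i * s + 1" for i
    by (rule Max_eqI) (auto simp: block_def)
  with * have "j * s + 1 = k * s + 1" by metis
  with assms show "j = k" by simp
qed

text \<open>Add the blocks in increasing order. Only the first point of the new block can lie in an
  earlier one, so each block after the first contributes at least \<open>s\<close> new points, while
  the first contributes \<open>s + 1\<close>. The extra point is the source of the factor
  \<open>1 / N\<close> in the variance bound.\<close>

lemma card_UN_block_ge:
  assumes "finite S" "S \<noteq> {}" "S \<subseteq> {1..}"
  shows "s * card S + 1 \<le> card (\<Union>k\<in>S. block s k)"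
  using assms
proof (induction S rule: finite_linorder_max_induct)
  case empty
  then show ?case by simp
next
  case (insert b S)
  show ?case
  proof (cases "S = {}")
    case True
    then show ?thesis using insert.prems by (simp add: card_block)
  next
    case False
    \<comment> \<open>\<open>?T\<close> is the new block without its first point, the one it would
      share with block \<open>b - 1\<close>.\<close>
    let ?U = "\<Union>k\<in>S. block s k" and ?T = "{(b - 1) * s + 2..b * s + 1}"
    have "?U \<subseteq> {..(b - 1) * s + 1}"
    proof
      fix x assume "x \<in> ?U"
      then obtain k where k: "k \<in> S" "x \<le> k * s + 1" by (auto simp: block_def)
      with insert have "k \<le> b - 1" by force
      then have "k * s \<le> (b - 1) * s" by (rule mult_le_mono1)
      with k(2) show "x \<in> {..(b - 1) * s + 1}" by (meson add_le_mono1 atMost_iff order_trans)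
    qed
    then have disj: "?U \<inter> ?T = {}" by force
    have "b \<ge> 1" using insert.prems by auto
    then have cT: "card ?T = s" by (cases b) auto
    have "s * card (insert b S) + 1 = (s * card S + 1) + card ?T"
      using insert cT by (auto simp: card_insert_if)
    also have "\<dots> \<le> card ?U + card ?T"
      using insert.IH insert.prems False by (intro add_right_mono) auto
    also have "\<dots> = card (?U \<union> ?T)"
      using disj insert by (subst card_Un_disjoint) auto
    also have "\<dots> \<le> card (\<Union>k\<in>insert b S. block s k)"
      using insert by (intro card_mono) (auto simp: block_def)
    finally show ?thesis .
  qed
qed

lemma ordered_loose_path_iff:
  "ordered_loose_path r n E l v \<longleftrightarrow>
     strict_mono_on {1..l * (r - 1) + 1} v \<and> v ` {1..l * (r - 1) + 1} \<subseteq> {1..n} \<and>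
     (\<lambda>k. v ` block (r - 1) k) ` {1..l} \<subseteq> E"
  unfolding ordered_loose_path_def block_def by blast

lemma path_edges_subset_r_subsets:
  assumes "r \<ge> 1" "strict_mono_on {1..l * (r - 1) + 1} v"
    "v ` {1..l * (r - 1) + 1} \<subseteq> {1..n}"
  shows "(\<lambda>k. v ` block (r - 1) k) ` {1..l} \<subseteq> r_subsets r n"
proof (clarsimp simp: r_subsets_def simp del: One_nat_def, intro conjI)
  fix k assume k: "1 \<le> k" "k \<le> l"
  then have sub: "block (r - 1) k \<subseteq> {1..l * (r - 1) + 1}"
    by (intro block_subset) auto
  then show "v ` block (r - 1) k \<subseteq> {1..n}" using assms(3) by blast
  have "inj_on v (block (r - 1) k)"
    using strict_mono_on_imp_inj_on[OF assms(2)] sub inj_on_subset by blast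
  then show "card (v ` block (r - 1) k) = r"
    using assms(1) k by (simp add: card_image card_block)
qed

text \<open>Distinct blocks have distinct images under an injective \<open>v\<close>. Hence a fixed
  path of length \<open>l\<close> is present with probability exactly \<open>p ^ l\<close>.\<close>

lemma card_path_edges:
  assumes "r \<ge> 2" "inj_on v {1..l * (r - 1) + 1}"
  shows "card ((\<lambda>k. v ` block (r - 1) k) ` {1..l}) = l"
proof -
  have "inj_on (\<lambda>k. v ` block (r - 1) k) {1..l}"
  proof (rule inj_onI)
    fix j k assume jk: "j \<in> {1..l}" "k \<in> {1..l}" "v ` block (r - 1) j = v ` block (r - 1) k"
    have "block (r - 1) j = block (r - 1) k"
      using inj_on_image_eq_iff[OF assms(2) block_subset[OF jk(1)] block_subset[OF jk(2)]] jk(3)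
      by blast
    then show "j = k"
      using inj_onD[OF inj_on_block[of "r - 1"]] jk(1,2) assms(1) by auto
  qed
  then show ?thesis by (simp add: card_image)
qed

section \<open>Edge probabilities and the second moment method\<close>

lemma finite_r_subsets [simp]: "finite (r_subsets r n)"
  unfolding r_subsets_def by (rule finite_subset[of _ "Pow {1..n}"]) auto

lemma prob_edges_subset:
  assumes "0 \<le> p" "p \<le> 1" "F \<subseteq> r_subsets r n"
  shows "measure_pmf.prob (random_hypergraph r n p) {E. F \<subseteq> E} = p ^ card F"
proof -
  \<comment> \<open>Containing \<open>F\<close> is a product event: coordinates in \<open>F\<close>
    are forced to be true, all others are free.\<close>
  let ?A = "r_subsets r n" and ?B = "\<lambda>e. if e \<in> F then {True} else UNIV"
  have "(\<lambda>f. {e \<in> ?A. f e}) -` {E. F \<subseteq> E} = Pi ?A ?B"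
    using assms(3) by (auto simp: Pi_def split: if_splits)
  then have "measure_pmf.prob (random_hypergraph r n p) {E. F \<subseteq> E} =
      (\<Prod>e\<in>?A. measure_pmf.prob (bernoulli_pmf p) (?B e))"
    by (simp add: random_hypergraph_def measure_Pi_pmf_Pi)
  also have "\<dots> = (\<Prod>e\<in>?A. if e \<in> F then p else 1)"
    using assms(1,2) by (intro prod.cong) (auto simp: measure_pmf_single)
  also have "\<dots> = (\<Prod>e\<in>F. p)"
    using assms(3) by (simp add: prod.inter_restrict[symmetric] Int_absorb1)
  finally show ?thesis by simp
qed

lemma finite_set_random_hypergraph: "finite (set_pmf (random_hypergraph r n p))"
  by (rule finite_subset[of _ "Pow (r_subsets r n)"]) (auto simp: random_hypergraph_def)

text \<open>Chebyshev for the number \<open>X\<close> of indices \<open>v\<close> with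
  \<open>F v\<close> present: if there are none, then \<open>X\<close> deviates from its mean by the
  whole mean. The variance over the squared mean is the quotient of the second moment by the squared
  mean, minus 1.\<close>

lemma second_moment_bound:
  fixes F :: "'v \<Rightarrow> nat set set"
  assumes p: "0 < p" "p \<le> 1" and V: "finite V" "V \<noteq> {}"
    and F: "\<And>v. v \<in> V \<Longrightarrow> F v \<subseteq> r_subsets r n" "\<And>v. v \<in> V \<Longrightarrow> card (F v) = l"
  shows "measure_pmf.prob (random_hypergraph r n p) {E. \<forall>v\<in>V. \<not> F v \<subseteq> E} \<le>
    (\<Sum>v\<in>V. \<Sum>w\<in>V. p ^ card (F v \<union> F w)) / (real (card V) * p ^ l)\<^sup>2 - 1"
proof -
  let ?M = "random_hypergraph r n p"
  define X where "X = (\<lambda>E. \<Sum>v\<in>V. indicator {E. F v \<subseteq> E} E :: real)"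
  define \<mu> where "\<mu> = real (card V) * p ^ l"
  have int: "integrable (measure_pmf ?M) f" for f :: "nat set set \<Rightarrow> real"
    by (rule integrable_measure_pmf_finite[OF finite_set_random_hypergraph])
  have \<mu>: "measure_pmf.expectation ?M X = \<mu>"
    using p F by (simp add: X_def \<mu>_def int prob_edges_subset)
  have "\<mu> > 0" using p V by (simp add: \<mu>_def card_gt_0_iff)
  \<comment> \<open>A product of two presence indicators is the presence indicator of the union,
    whose expectation is a power of \<open>p\<close>.\<close>
  have "(\<lambda>E. (X E)\<^sup>2) = (\<lambda>E. \<Sum>v\<in>V. \<Sum>w\<in>V. indicator {E. F v \<union> F w \<subseteq> E} E :: real)"
    by (auto simp: X_def power2_eq_square sum_product indicator_def intro!: ext sum.cong)
  moreover have "measure_pmf.prob ?M {E. F v \<union> F w \<subseteq> E} = p ^ card (F v \<union> F w)"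
    if "v \<in> V" "w \<in> V" for v w
    using that p F by (intro prob_edges_subset) auto
  ultimately have sq: "measure_pmf.expectation ?M (\<lambda>E. (X E)\<^sup>2) =
      (\<Sum>v\<in>V. \<Sum>w\<in>V. p ^ card (F v \<union> F w))"
    by (simp add: int del: Un_subset_iff)
  have "measure_pmf.prob ?M {E. \<forall>v\<in>V. \<not> F v \<subseteq> E} \<le>
      measure_pmf.prob ?M {E. \<mu> \<le> \<bar>X E - measure_pmf.expectation ?M X\<bar>}"
    unfolding \<mu> using \<open>\<mu> > 0\<close>
    by (intro measure_pmf.finite_measure_mono) (auto simp: X_def)
  also have "\<dots> \<le> measure_pmf.variance ?M X / \<mu>\<^sup>2"
    using measure_pmf.Chebyshev_inequality[where M = ?M and f = X and a = \<mu>] int \<open>\<mu> > 0\<close> by simp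
  also have "measure_pmf.variance ?M X =
      (\<Sum>v\<in>V. \<Sum>w\<in>V. p ^ card (F v \<union> F w)) - \<mu>\<^sup>2"
    by (subst measure_pmf.variance_eq) (auto simp: int sq \<mu>)
  finally show ?thesis
    using \<open>\<mu> > 0\<close> by (simp add: diff_divide_distrib flip: \<mu>_def)
qed

section \<open>Layered maps\<close>

text \<open>The extensional product fixes the values outside \<open>{1..m}\<close>, so a map is
  determined by its \<open>m\<close> relevant vertices and the maps can be counted.\<close>

definition layered_maps :: "nat \<Rightarrow> nat \<Rightarrow> (nat \<Rightarrow> nat) set" where
  "layered_maps N m = PiE {1..m} (\<lambda>i. {(i - 1) * N + 1..i * N})"

lemma finite_layered_maps [simp]: "finite (layered_maps N m)"
  unfolding layered_maps_def by (intro finite_PiE) auto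

lemma card_layer: "i \<ge> 1 \<Longrightarrow> card {(i - 1) * N + 1..i * N} = N"
  by (cases i) auto

lemma card_layered_maps: "card (layered_maps N m) = N ^ m"
  unfolding layered_maps_def
  by (subst card_PiE)
     (simp_all add: card_layer del: One_nat_def card_atLeastAtMost, simp)

lemma layered_maps_mem:
  "v \<in> layered_maps N m \<Longrightarrow> i \<in> {1..m} \<Longrightarrow> (i - 1) * N + 1 \<le> v i \<and> v i \<le> i * N"
  by (auto simp: layered_maps_def PiE_def Pi_def)

lemma layered_maps_less:
  assumes "v \<in> layered_maps N m" "w \<in> layered_maps N m" "i \<in> {1..m}" "j \<in> {1..m}" "i < j"
  shows "v i < w j"
proof -
  have "i * N \<le> (j - 1) * N" using assms(5) by (intro mult_le_mono1) auto
  with layered_maps_mem[OF assms(1,3)] layered_maps_mem[OF assms(2,4)] show ?thesis by linarith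
qed

lemma layered_maps_index_eq:
  assumes "v \<in> layered_maps N m" "w \<in> layered_maps N m" "i \<in> {1..m}" "j \<in> {1..m}" "v i = w j"
  shows "i = j"
  using layered_maps_less[OF assms(1-4)] layered_maps_less[OF assms(2,1,4,3)] assms(5)
  by (cases i j rule: linorder_cases) auto

text \<open>The layers are disjoint and common to all the maps, so a vertex reveals its position.
  Equal images therefore come from the same positions, with agreement at each of them.\<close>

lemma layered_maps_image_eq_iff:
  assumes "v \<in> layered_maps N m" "w \<in> layered_maps N m" "A \<subseteq> {1..m}" "B \<subseteq> {1..m}"
  shows "v ` A = w ` B \<longleftrightarrow> A = B \<and> (\<forall>i\<in>A. v i = w i)"
proof
  assume eq: "v ` A = w ` B"
  have "i \<in> B \<and> v i = w i" if "i \<in> A" for i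
  proof -
    from that eq obtain j where "j \<in> B" "v i = w j" by blast
    with layered_maps_index_eq[OF assms(1,2), of i j] that assms(3,4) show ?thesis by blast
  qed
  moreover have "i \<in> A" if "i \<in> B" for i
  proof -
    from that eq obtain j where "j \<in> A" "v j = w i" by (metis imageE imageI)
    with layered_maps_index_eq[OF assms(1,2), of j i] that assms(3,4) show ?thesis by blast
  qed
  ultimately show "A = B \<and> (\<forall>i\<in>A. v i = w i)" by blast
qed auto

lemma strict_mono_on_layered_maps: "v \<in> layered_maps N m \<Longrightarrow> strict_mono_on {1..m} v"
  by (rule strict_mono_onI) (rule layered_maps_less)

lemma layered_maps_image_subset:
  assumes "v \<in> layered_maps N m" "m * N \<le> n"
  shows "v ` {1..m} \<subseteq> {1..n}"
proof (rule image_subsetI)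
  fix i assume i: "i \<in> {1..m}"
  then have "i * N \<le> m * N" by (intro mult_le_mono1) auto
  with layered_maps_mem[OF assms(1) i] assms(2) show "v i \<in> {1..n}"
    unfolding atLeastAtMost_iff by linarith
qed

text \<open>Prescribing the values on \<open>U\<close> leaves a product of singletons and full
  layers. The multiplicative form avoids the truncated difference \<open>m - card U\<close> in an
  exponent.\<close>

lemma card_layered_maps_agreeing:
  assumes "v \<in> layered_maps N m" "U \<subseteq> {1..m}"
  shows "card {w \<in> layered_maps N m. \<forall>i\<in>U. v i = w i} * N ^ card U = N ^ m"
proof -
  let ?I = "\<lambda>i. {(i - 1) * N + 1..i * N}"
  have "{w \<in> layered_maps N m. \<forall>i\<in>U. v i = w i} =
      PiE {1..m} (\<lambda>i. if i \<in> U then {v i} else ?I i)" (is "_ = ?P")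
  proof (intro set_eqI iffI)
    fix w assume "w \<in> ?P"
    then have w: "w \<in> extensional {1..m}"
      "\<And>i. i \<in> {1..m} \<Longrightarrow> w i \<in> (if i \<in> U then {v i} else ?I i)"
      by (auto simp: PiE_def Pi_def)
    have "w i \<in> ?I i" if "i \<in> {1..m}" for i
      using w(2)[OF that] layered_maps_mem[OF assms(1) that] by (auto split: if_splits)
    moreover have "\<forall>i\<in>U. v i = w i" using w(2) assms(2) by fastforce
    ultimately show "w \<in> {w \<in> layered_maps N m. \<forall>i\<in>U. v i = w i}"
      using w(1) by (auto simp: layered_maps_def PiE_def Pi_def)
  qed (auto simp: layered_maps_def PiE_def Pi_def)
  then have "card {w \<in> layered_maps N m. \<forall>i\<in>U. v i = w i} =
      (\<Prod>i\<in>{1..m}. card (if i \<in> U then {v i} else ?I i))"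
    by (simp add: card_PiE)
  also have "\<dots> = (\<Prod>i\<in>{1..m}. if i \<in> U then 1 else N)"
    by (intro prod.cong) (auto simp: card_layer simp del: One_nat_def card_atLeastAtMost)
  finally have *: "card {w \<in> layered_maps N m. \<forall>i\<in>U. v i = w i} =
      (\<Prod>i\<in>{1..m}. if i \<in> U then 1 else N)" .
  have "N ^ card U = (\<Prod>i\<in>{1..m}. if i \<in> U then N else 1)"
    using assms(2) by (simp add: prod.inter_restrict[symmetric] Int_absorb1)
  then have "card {w \<in> layered_maps N m. \<forall>i\<in>U. v i = w i} * N ^ card U = (\<Prod>i\<in>{1..m}. N)"
    unfolding * by (simp only: prod.distrib[symmetric]) (intro prod.cong, auto)
  then show ?thesis by simp
qed

section \<open>Second moment of the number of layered paths\<close>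

lemma prod_one_plus:
  fixes f :: "'a \<Rightarrow> 'b :: comm_semiring_1"
  assumes "finite A"
  shows "(\<Prod>k\<in>A. 1 + f k) = (\<Sum>S\<in>Pow A. \<Prod>k\<in>S. f k)"
  using prod_add[OF assms, of f "\<lambda>_. 1"] by (simp add: add.commute)

text \<open>Expanding \<open>(1 / p) ^ j = (\<Prod>k. 1 + (1 / p - 1) * [edge k is shared])\<close>, where \<open>j\<close> is the number
  of edges shared by two layered paths, turns the sum over \<open>w\<close> into a sum over edge sets \<open>S\<close>;
  a nonempty \<open>S\<close> prescribes at least \<open>(r - 1) * card S + 1\<close> vertices of \<open>w\<close>.\<close>

lemma layered_pair_sum_le:
  fixes l :: nat and p :: real
  assumes r: "r \<ge> 2" and p: "0 < p" "p \<le> 1" and N: "N \<ge> 1"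
    and v: "v \<in> layered_maps N (l * (r - 1) + 1)"
  defines "F \<equiv> \<lambda>v :: nat \<Rightarrow> nat. (\<lambda>k. v ` block (r - 1) k) ` {1..l}"
  shows "(\<Sum>w\<in>layered_maps N (l * (r - 1) + 1). p ^ card (F v \<union> F w)) \<le>
    p ^ (2 * l) * real N ^ (l * (r - 1) + 1) *
      (1 + 1 / real N * (1 + 1 / (p * real N ^ (r - 1))) ^ l)"
proof -
  define s where "s = r - 1"
  define m where "m = l * s + 1"
  define V where "V = layered_maps N m"
  define q where "q = 1 / p - 1"
  define agr where "agr = (\<lambda>w. {k \<in> {1..l}. \<forall>i\<in>block s k. v i = w i})"
  have q: "0 \<le> q" using p by (simp add: q_def)
  have vV: "v \<in> V" using v by (simp add: V_def m_def s_def)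
  have cF: "card (F w) = l" if "w \<in> V" for w
    unfolding F_def using that strict_mono_on_imp_inj_on[OF strict_mono_on_layered_maps, of w N m] r
    by (intro card_path_edges) (auto simp: V_def m_def s_def)
  have bs: "block s k \<subseteq> {1..m}" if "k \<in> {1..l}" for k
    using block_subset[OF that] by (simp add: m_def)
  have eqb: "v ` block s j = w ` block s k \<longleftrightarrow> j = k \<and> (\<forall>i\<in>block s k. v i = w i)"
    if "w \<in> V" "j \<in> {1..l}" "k \<in> {1..l}" for w j k
  proof -
    have "block s j = block s k \<longleftrightarrow> j = k"
      using inj_on_block[of s] that r by (auto simp: s_def inj_on_def)
    then show ?thesis
      using layered_maps_image_eq_iff[of v N m w "block s j" "block s k"] that vV bs
      by (auto simp: V_def)
  qed
  have pc: "p ^ card (F v \<union> F w) = p ^ (2 * l) * (\<Sum>S\<in>Pow {1..l}. if S \<subseteq> agr w then q ^ card S else 0)"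
    if w: "w \<in> V" for w
  proof -
    \<comment> \<open>Shared edges correspond exactly to the positions in \<open>agr w\<close>, so
      by inclusion-exclusion the union has \<open>2 * l - card (agr w)\<close> edges.\<close>
    have "F v \<inter> F w = (\<lambda>k. v ` block s k) ` agr w"
      using eqb[OF w] unfolding F_def s_def[symmetric] agr_def by blast
    moreover have "inj_on (\<lambda>k. v ` block s k) (agr w)"
      using eqb[OF vV] unfolding agr_def inj_on_def by blast
    ultimately have ci: "card (F v \<inter> F w) = card (agr w)" by (simp add: card_image)
    have "card (F v \<union> F w) + card (agr w) = 2 * l"
      using card_Un_Int[of "F v" "F w"] ci cF[OF w] cF[OF vV] by (simp add: F_def)
    then have "p ^ card (F v \<union> F w) * p ^ card (agr w) = p ^ (2 * l)"
      by (metis power_add)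
    then have "p ^ card (F v \<union> F w) = p ^ (2 * l) * (1 / p) ^ card (agr w)"
      using p by (simp add: field_simps)
    also have "(1 / p) ^ card (agr w) = (\<Prod>k\<in>agr w. 1 / p)" by simp
    also have "\<dots> = (\<Prod>k\<in>{1..l}. if k \<in> agr w then 1 / p else 1)"
    proof -
      have "agr w \<subseteq> {1..l}" by (auto simp: agr_def)
      then show ?thesis by (simp add: prod.inter_restrict[symmetric] Int_absorb1)
    qed
    also have "\<dots> = (\<Prod>k\<in>{1..l}. 1 + (if k \<in> agr w then q else 0))"
      by (intro prod.cong) (auto simp: q_def)
    also have "\<dots> = (\<Sum>S\<in>Pow {1..l}. \<Prod>k\<in>S. if k \<in> agr w then q else 0)"
      by (rule prod_one_plus) simp
    also have "\<dots> = (\<Sum>S\<in>Pow {1..l}. if S \<subseteq> agr w then q ^ card S else 0)"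
    proof (intro sum.cong refl)
      fix S assume "S \<in> Pow {1..l}"
      then have fin: "finite S" using finite_subset by auto
      show "(\<Prod>k\<in>S. if k \<in> agr w then q else 0) = (if S \<subseteq> agr w then q ^ card S else 0)"
      proof (cases "S \<subseteq> agr w")
        case True
        then have "(\<Prod>k\<in>S. if k \<in> agr w then q else 0) = (\<Prod>k\<in>S. q)" by (intro prod.cong) auto
        with True show ?thesis by simp
      next
        case False
        then show ?thesis using fin by (auto intro!: prod_zero)
      qed
    qed
    finally show ?thesis .
  qed
  \<comment> \<open>For nonempty \<open>S\<close> only the second summand is present. For empty
    \<open>S\<close> the first one is already exact; the surplus \<open>1 / N\<close> is kept so
    that the second summand runs over all of \<open>Pow {1..l}\<close> and refolds into a
    product.\<close>
  have cnt: "real (card {w \<in> V. S \<subseteq> agr w}) \<le>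
      real N ^ m * ((if S = {} then 1 else 0) + 1 / (real N * real N ^ (s * card S)))"
    if S: "S \<in> Pow {1..l}" for S
  proof -
    define U where "U = (\<Union>k\<in>S. block s k)"
    have "{w \<in> V. S \<subseteq> agr w} = {w \<in> V. \<forall>i\<in>U. v i = w i}"
      using S by (auto simp: agr_def U_def)
    moreover have "U \<subseteq> {1..m}" using S bs by (fastforce simp: U_def)
    ultimately have "card {w \<in> V. S \<subseteq> agr w} * N ^ card U = N ^ m"
      using card_layered_maps_agreeing[of v N m U] vV by (simp add: V_def)
    then have c: "real (card {w \<in> V. S \<subseteq> agr w}) * real N ^ card U = real N ^ m"
      by (metis of_nat_mult of_nat_power)
    show ?thesis
    proof (cases "S = {}")
      case True
      then show ?thesis using c N by (simp add: U_def)
    next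
      case False
      have "finite S" using S finite_subset by auto
      then have "s * card S + 1 \<le> card U"
        unfolding U_def using S False by (intro card_UN_block_ge) auto
      then have "real N ^ (s * card S + 1) \<le> real N ^ card U"
        using N by (intro power_increasing) auto
      then have "real (card {w \<in> V. S \<subseteq> agr w}) * real N ^ (s * card S + 1) \<le> real N ^ m"
        unfolding c[symmetric] by (intro mult_left_mono) auto
      then show ?thesis using N False by (simp add: field_simps)
    qed
  qed
  have "(\<Sum>w\<in>V. p ^ card (F v \<union> F w)) =
      p ^ (2 * l) * (\<Sum>w\<in>V. \<Sum>S\<in>Pow {1..l}. if S \<subseteq> agr w then q ^ card S else 0)"
    by (simp add: pc sum_distrib_left)
  also have "(\<Sum>w\<in>V. \<Sum>S\<in>Pow {1..l}. if S \<subseteq> agr w then q ^ card S else 0) =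
      (\<Sum>S\<in>Pow {1..l}. \<Sum>w\<in>V. if S \<subseteq> agr w then q ^ card S else 0)"
    by (rule sum.swap)
  also have "\<dots> = (\<Sum>S\<in>Pow {1..l}. q ^ card S * real (card {w \<in> V. S \<subseteq> agr w}))"
  proof (intro sum.cong refl)
    fix S
    have "(\<Sum>w\<in>V. if S \<subseteq> agr w then q ^ card S else 0) = (\<Sum>w\<in>{w\<in>V. S \<subseteq> agr w}. q ^ card S)"
      by (rule sum.inter_filter[symmetric]) (simp add: V_def)
    then show "(\<Sum>w\<in>V. if S \<subseteq> agr w then q ^ card S else 0) = q ^ card S * real (card {w \<in> V. S \<subseteq> agr w})"
      by simp
  qed
  also have "\<dots> \<le> (\<Sum>S\<in>Pow {1..l}. q ^ card S *
      (real N ^ m * ((if S = {} then 1 else 0) + 1 / (real N * real N ^ (s * card S)))))"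
    using cnt q by (intro sum_mono mult_left_mono) auto
  also have "\<dots> = (\<Sum>S\<in>Pow {1..l}. real N ^ m * (if S = {} then 1 else 0) +
      real N ^ m * (1 / real N * (\<Prod>k\<in>S. q / real N ^ s)))"
  proof (intro sum.cong refl)
    fix S
    have "(\<Prod>k\<in>S. q / real N ^ s) = q ^ card S / real N ^ (s * card S)"
      by (simp add: power_divide power_mult)
    then show "q ^ card S *
      (real N ^ m * ((if S = {} then 1 else 0) + 1 / (real N * real N ^ (s * card S)))) =
      real N ^ m * (if S = {} then 1 else 0) + real N ^ m * (1 / real N * (\<Prod>k\<in>S. q / real N ^ s))"
      by (cases "S = {}") (simp_all add: distrib_left)
  qed
  \<comment> \<open>The indicators of the empty set sum to 1, and the other sum is an expanded
    product.\<close>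
  also have "\<dots> = real N ^ m * (1 + 1 / real N * (\<Prod>k\<in>{1..l}. 1 + q / real N ^ s))"
  proof -
    have "(\<Sum>S\<in>Pow {1..l}. if S = {} then 1 else 0 :: real) = 1"
      by (subst sum.delta) auto
    then show ?thesis
      unfolding sum.distrib sum_distrib_left[symmetric]
      by (subst prod_one_plus) (simp_all only: finite_atLeastAtMost distrib_left mult_1_right)
  qed
  also have "\<dots> \<le> real N ^ m * (1 + 1 / real N * (1 + 1 / (p * real N ^ s)) ^ l)"
  proof -
    have "q / real N ^ s \<le> 1 / p / real N ^ s"
      by (intro divide_right_mono) (auto simp: q_def)
    then have "(1 + q / real N ^ s) ^ l \<le> (1 + 1 / (p * real N ^ s)) ^ l"
      using q by (intro power_mono) auto
    then show ?thesis by (auto intro!: mult_left_mono divide_right_mono)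
  qed
  finally show ?thesis
    using p by (simp add: V_def m_def s_def mult.assoc)
qed

text \<open>When \<open>m\<close> layers of length \<open>N\<close> fit into \<open>{1..n}\<close>,
  every layered map whose edges are present is an ordered loose path, so it suffices to bound the
  probability that none is present.\<close>

lemma prob_no_path_le:
  assumes r: "r \<ge> 2" and p: "0 < p" "p \<le> 1" and N: "N \<ge> 1" and n: "(l * (r - 1) + 1) * N \<le> n"
  shows "measure_pmf.prob (random_hypergraph r n p) {E. \<forall>v. \<not> ordered_loose_path r n E l v} \<le>
    1 / real N * (1 + 1 / (p * real N ^ (r - 1))) ^ l"
proof -
  define m where "m = l * (r - 1) + 1"
  define V where "V = layered_maps N m"
  define F where "F = (\<lambda>v :: nat \<Rightarrow> nat. (\<lambda>k. v ` block (r - 1) k) ` {1..l})"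
  define b where "b = 1 / real N * (1 + 1 / (p * real N ^ (r - 1))) ^ l"
  have V: "strict_mono_on {1..m} v" "v ` {1..m} \<subseteq> {1..n}" if "v \<in> V" for v
    using that strict_mono_on_layered_maps layered_maps_image_subset n by (auto simp: V_def m_def)
  have cV: "card V = N ^ m" "finite V" by (simp_all add: V_def card_layered_maps)
  have "measure_pmf.prob (random_hypergraph r n p) {E. \<forall>v. \<not> ordered_loose_path r n E l v} \<le>
      measure_pmf.prob (random_hypergraph r n p) {E. \<forall>v\<in>V. \<not> F v \<subseteq> E}"
    using V unfolding m_def
    by (intro measure_pmf.finite_measure_mono) (auto simp: ordered_loose_path_iff F_def)
  also have "\<dots> \<le> (\<Sum>v\<in>V. \<Sum>w\<in>V. p ^ card (F v \<union> F w)) / (real (card V) * p ^ l)\<^sup>2 - 1"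
  proof (rule second_moment_bound)
    show "V \<noteq> {}" using cV N by auto
    show "F v \<subseteq> r_subsets r n" if "v \<in> V" for v
      using path_edges_subset_r_subsets[of r l v n] V[OF that] r by (simp add: F_def m_def)
    show "card (F v) = l" if "v \<in> V" for v
      using card_path_edges[of r v l] strict_mono_on_imp_inj_on[OF V(1)[OF that]] r
      by (simp add: F_def m_def)
  qed (use p cV in auto)
  also have "\<dots> \<le> (\<Sum>v\<in>V. p ^ (2 * l) * real N ^ m * (1 + b)) / (real (card V) * p ^ l)\<^sup>2 - 1"
    using layered_pair_sum_le[OF r p N] unfolding V_def m_def F_def b_def
    by (intro diff_right_mono divide_right_mono sum_mono) auto
  \<comment> \<open>As \<open>card V = N ^ m\<close>, the main term is exactly the squared mean;
    after division and subtraction of 1 only \<open>b\<close> survives.\<close>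
  also have "(\<Sum>v\<in>V. p ^ (2 * l) * real N ^ m * (1 + b)) = (real (card V) * p ^ l)\<^sup>2 * (1 + b)"
    by (simp add: cV power2_eq_square mult_2 power_add)
  also have "\<dots> / (real (card V) * p ^ l)\<^sup>2 - 1 = b"
    using p N by (simp add: cV)
  finally show ?thesis by (simp add: b_def)
qed

section \<open>The maximal length\<close>

lemma ordered_loose_path_prefix:
  assumes "ordered_loose_path r n E l v" "l' \<le> l"
  shows "ordered_loose_path r n E l' v"
proof -
  have "l' * (r - 1) \<le> l * (r - 1)" using assms(2) by (rule mult_le_mono1)
  then have sub: "{1..l' * (r - 1) + 1} \<subseteq> {1..l * (r - 1) + 1}" by simp
  have "v ` {1..l' * (r - 1) + 1} \<subseteq> v ` {1..l * (r - 1) + 1}"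
    by (rule image_mono[OF sub])
  moreover have "{1..l'} \<subseteq> {1..l}" using assms(2) by simp
  ultimately show ?thesis
    using assms(1) sub unfolding ordered_loose_path_def strict_mono_on_def by blast
qed

lemma ordered_loose_path_length_le:
  assumes "r \<ge> 2" "ordered_loose_path r n E l v"
  shows "l \<le> n"
proof -
  have v: "inj_on v {1..l * (r - 1) + 1}" "v ` {1..l * (r - 1) + 1} \<subseteq> {1..n}"
    using assms(2) strict_mono_on_imp_inj_on by (auto simp: ordered_loose_path_def)
  have "l * (r - 1) + 1 \<le> n"
    using card_inj_on_le[OF v] by simp
  moreover have "l * 1 \<le> l * (r - 1)" using assms(1) by (intro mult_le_mono2) simp
  ultimately show ?thesis by linarith
qed

lemma finite_path_lengths: "r \<ge> 2 \<Longrightarrow> finite {l. \<exists>v. ordered_loose_path r n E l v}"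
  by (rule finite_subset[of _ "{..n}"]) (auto dest: ordered_loose_path_length_le)

lemma l_max_ge: "r \<ge> 2 \<Longrightarrow> ordered_loose_path r n E l v \<Longrightarrow> l \<le> l_max r n E"
  unfolding l_max_def by (rule Max_ge) (auto intro: finite_path_lengths)

text \<open>Prefixes of paths are paths, so excluding one length excludes all larger ones. The
  one-vertex path, available because \<open>n \<ge> 1\<close>, makes the maximum range over a
  nonempty set.\<close>

lemma l_max_less:
  assumes "r \<ge> 2" "n \<ge> 1" "\<And>v. \<not> ordered_loose_path r n E l v"
  shows "l_max r n E < l"
proof -
  have "ordered_loose_path r n E 0 (\<lambda>_. 1)"
    using assms(2) by (auto simp: ordered_loose_path_def strict_mono_on_def)
  then have "{l. \<exists>v. ordered_loose_path r n E l v} \<noteq> {}" by blast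
  from Max_in[OF finite_path_lengths[OF assms(1)] this]
  obtain v where "ordered_loose_path r n E (l_max r n E) v" by (auto simp: l_max_def)
  with ordered_loose_path_prefix assms(3) show ?thesis by (meson not_le)
qed

section \<open>Counting paths and the union bound\<close>

text \<open>An increasing map is determined by its image: its list of values is the sorted
  enumeration of that set.\<close>

lemma card_strict_mono_maps_le:
  "card {v \<in> PiE {1..m} (\<lambda>_. {1..n}). strict_mono_on {1..m} v} \<le> n choose m"
proof -
  let ?V = "{v \<in> PiE {1..m} (\<lambda>_. {1..n}). strict_mono_on {1..m} (v :: nat \<Rightarrow> nat)}"
  let ?A = "{A. A \<subseteq> {1..n} \<and> card A = m}"
  have sorted: "sorted_wrt (<) (map v [1..<m + 1])" if "v \<in> ?V" for v
    unfolding sorted_wrt_map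
    by (rule sorted_wrt_mono_rel[OF _ sorted_wrt_upt]) (use that in \<open>auto simp: strict_mono_on_def\<close>)
  have "inj_on (\<lambda>v. v ` {1..m}) ?V"
  proof (rule inj_onI)
    fix v w assume vw: "v \<in> ?V" "w \<in> ?V" "v ` {1..m} = w ` {1..m}"
    have "set [1..<m + 1] = {1..m}" by auto
    then have "map v [1..<m + 1] = map w [1..<m + 1]"
      using strict_sorted_equal[OF sorted[OF vw(1)] sorted[OF vw(2)]] vw(3) by simp
    then have "\<forall>i\<in>{1..m}. v i = w i" by (auto simp: map_eq_conv)
    then show "v = w" using vw(1,2) by (auto intro: PiE_ext)
  qed
  moreover have "(\<lambda>v. v ` {1..m}) ` ?V \<subseteq> ?A"
  proof (rule image_subsetI)
    fix v assume v: "v \<in> ?V"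
    then have "inj_on v {1..m}" using strict_mono_on_imp_inj_on by auto
    with v show "v ` {1..m} \<in> ?A" by (auto simp: card_image)
  qed
  moreover have "finite ?A" by (rule finite_subset[of _ "Pow {1..n}"]) auto
  ultimately have "card ?V \<le> card ?A" by (rule card_inj_on_le)
  also have "card ?A = n choose m" by (simp add: n_subsets)
  finally show ?thesis .
qed

lemma prob_path_le:
  assumes "r \<ge> 2" "0 \<le> p" "p \<le> 1"
  shows "measure_pmf.prob (random_hypergraph r n p) {E. \<exists>v. ordered_loose_path r n E l v} \<le>
    real (n choose (l * (r - 1) + 1)) * p ^ l"
proof -
  define m where "m = l * (r - 1) + 1"
  define V where "V = {v \<in> PiE {1..m} (\<lambda>_. {1..n}). strict_mono_on {1..m} v}"
  let ?F = "\<lambda>v :: nat \<Rightarrow> nat. (\<lambda>k. v ` block (r - 1) k) ` {1..l}"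
  let ?M = "random_hypergraph r n p"
  have fV: "finite V" by (auto simp: V_def intro!: finite_PiE)
  have "{E. \<exists>v. ordered_loose_path r n E l v} \<subseteq> (\<Union>v\<in>V. {E. ?F v \<subseteq> E})"
  proof (safe)
    fix E v assume v: "ordered_loose_path r n E l v"
    \<comment> \<open>The path predicate ignores values outside \<open>{1..m}\<close>; restricting
      moves \<open>v\<close> into the finite set \<open>V\<close> without changing its
      edges.\<close>
    let ?w = "restrict v {1..m}"
    have "?w ` block (r - 1) k = v ` block (r - 1) k" if "k \<in> {1..l}" for k
      using block_subset[OF that, of "r - 1"] by (intro image_cong) (auto simp: m_def)
    then have F_eq: "?F ?w = ?F v" by (rule image_cong[OF refl])
    have "?w \<in> V"
      using v by (auto simp: V_def m_def ordered_loose_path_def strict_mono_on_def)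
    moreover have "?F v \<subseteq> E" using v by (simp add: ordered_loose_path_iff)
    ultimately show "E \<in> (\<Union>v\<in>V. {E. ?F v \<subseteq> E})"
      using F_eq by (intro UN_I[of ?w]) (simp_all only: mem_Collect_eq)
  qed
  then have "measure_pmf.prob ?M {E. \<exists>v. ordered_loose_path r n E l v} \<le>
      measure_pmf.prob ?M (\<Union>v\<in>V. {E. ?F v \<subseteq> E})"
    by (intro measure_pmf.finite_measure_mono) auto
  also have "\<dots> \<le> (\<Sum>v\<in>V. measure_pmf.prob ?M {E. ?F v \<subseteq> E})"
    by (intro measure_UNION_le fV) auto
  also have "\<dots> = (\<Sum>v\<in>V. p ^ l)"
  proof (intro sum.cong refl)
    fix v assume "v \<in> V"
    then have v: "strict_mono_on {1..m} v" "v ` {1..m} \<subseteq> {1..n}" by (auto simp: V_def)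
    have "?F v \<subseteq> r_subsets r n"
      using path_edges_subset_r_subsets[of r l v n] v assms(1) by (simp add: m_def)
    moreover have "card (?F v) = l"
      using card_path_edges[of r v l] strict_mono_on_imp_inj_on[OF v(1)] assms(1) by (simp add: m_def)
    ultimately show "measure_pmf.prob ?M {E. ?F v \<subseteq> E} = p ^ l"
      using prob_edges_subset[OF assms(2,3)] by simp
  qed
  also have "\<dots> = real (card V) * p ^ l" by simp
  also have "\<dots> \<le> real (n choose m) * p ^ l"
    using card_strict_mono_maps_le[of m n] assms(2)
    by (intro mult_right_mono) (auto simp: V_def)
  finally show ?thesis by (simp add: m_def)
qed

lemma binomial_le_exp_power:
  assumes "m \<ge> 1"
  shows "real (n choose m) \<le> (exp 1 * real n / real m) ^ m"
proof -
  have "real m ^ m / fact m \<le> exp (real m)"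
  proof -
    \<comment> \<open>The quotient \<open>m ^ m / fact m\<close> is a single term of the exponential
      series at \<open>m\<close>.\<close>
    have "(\<Sum>k\<in>{m}. real m ^ k /\<^sub>R fact k) \<le> (\<Sum>k. real m ^ k /\<^sub>R fact k)"
      by (intro sum_le_suminf summable_exp_generic) auto
    then show ?thesis by (simp add: exp_def field_simps)
  qed
  then have "1 / fact m \<le> (exp 1 / real m) ^ m"
    using assms by (simp add: power_divide field_simps flip: exp_of_nat_mult)
  have "real (n choose m) * fact m \<le> real n ^ m"
    using binomial_fact_pow[of n m] by (metis of_nat_fact of_nat_le_iff of_nat_mult of_nat_power)
  then have "real (n choose m) \<le> real n ^ m * (1 / fact m)"
    by (simp add: field_simps)
  also have "\<dots> \<le> real n ^ m * (exp 1 / real m) ^ m"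
    using \<open>1 / fact m \<le> _\<close> by (intro mult_left_mono) auto
  finally show ?thesis by (simp add: power_mult_distrib power_divide mult.commute)
qed

section \<open>Moment estimates from the defining equation of \<open>l0\<close>\<close>

lemma edge_prob_eq_powr:
  fixes L x p :: real
  assumes "0 < L" "0 < x" "(x / L) powr a * p = 1"
  shows "p = (L / x) powr a"
proof -
  have "(L / x) powr a = inverse ((x / L) powr a)"
    using assms(1,2) by (simp add: powr_divide)
  moreover have "inverse ((x / L) powr a) = p"
    using assms(3) by (intro inverse_unique)
  ultimately show ?thesis by simp
qed

text \<open>With \<open>x = L / n\<close> the equation reads \<open>p = x powr (s + 1 / L)\<close>,
  so \<open>l \<ge> 2 * L\<close> gives \<open>p ^ l \<le> x ^ (l * s) * x ^ 2\<close>. The binomial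
  coefficient is at most \<open>(e * n / m) ^ m\<close>. Since \<open>r \<ge> 3\<close>,
  \<open>m\<close> is at least \<open>4 * L\<close>, so every factor \<open>e * n / m\<close> paired
  with one \<open>x\<close> is at most 1.\<close>

lemma first_moment_le:
  fixes L p :: real
  assumes r: "r \<ge> 3" and L: "1 \<le> L" "L \<le> real n" "2 * L \<le> real l"
    and eq: "(real n / L) powr (real r - 1 + 1 / L) * p = 1"
  shows "real (n choose (l * (r - 1) + 1)) * p ^ l \<le> 3 * L\<^sup>2 / real n"
proof -
  define s where "s = r - 1"
  define m where "m = l * s + 1"
  define x where "x = L / real n"
  have n: "0 < real n" using L by linarith
  have x: "0 < x" "x \<le> 1" using L n by (auto simp: x_def)
  have rs: "real r - 1 = real s" using r by (simp add: s_def)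
  have "p = x powr (real s + 1 / L)"
    using edge_prob_eq_powr[OF _ n eq] L unfolding x_def rs by simp
  then have "p ^ l = x powr (real (l * s) + real l / L)"
    using x by (simp add: powr_powr distrib_left mult.commute flip: powr_realpow)
  also have "\<dots> = x ^ (l * s) * x powr (real l / L)"
    using x powr_realpow[of x "l * s"] by (simp add: powr_add)
  also have "\<dots> \<le> x ^ (l * s) * x powr 2"
    using x L by (intro mult_left_mono powr_mono') (auto simp: field_simps)
  finally have pl: "p ^ l \<le> x ^ (l * s) * x\<^sup>2" using x by (simp add: powr_numeral)
  have "real l * 2 \<le> real l * real s" using r by (intro mult_left_mono) (auto simp: s_def)
  moreover have "real m = real l * real s + 1" by (simp add: m_def)
  ultimately have m: "4 * L \<le> real m" using L by linarith
  have "exp 1 * L \<le> 3 * L" using L exp_le by (intro mult_right_mono) auto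
  then have "exp 1 * L \<le> real m" using m L by linarith
  then have a: "exp 1 * real n / real m * x \<le> 1"
    using m L n by (simp add: x_def divide_le_eq)
  have "exp 1 * real n / real m \<le> 3 * real n / 1"
    using exp_le m L by (intro frac_le mult_right_mono) auto
  then have b: "exp 1 * real n / real m \<le> 3 * real n" by simp
  have "real (n choose m) * p ^ l \<le> (exp 1 * real n / real m) ^ m * (x ^ (l * s) * x\<^sup>2)"
    using pl x by (intro mult_mono binomial_le_exp_power) (auto simp: m_def \<open>p = _\<close>)
  \<comment> \<open>Because \<open>m = l * s + 1\<close>, one factor \<open>e * n / m\<close> has no
    partner; it is combined with the gained \<open>x ^ 2\<close> and yields the whole bound.\<close>
  also have "\<dots> = (exp 1 * real n / real m * x) ^ (l * s) * ((exp 1 * real n / real m) * x\<^sup>2)"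
  proof -
    have "y ^ m * (x ^ (l * s) * x\<^sup>2) = (y * x) ^ (l * s) * (y * x\<^sup>2)" for y
      by (simp add: m_def power_mult_distrib)
    then show ?thesis .
  qed
  also have "\<dots> \<le> 1 * (3 * real n * x\<^sup>2)"
    using a b x by (intro mult_mono mult_right_mono power_le_one) auto
  also have "\<dots> = 3 * L\<^sup>2 / real n"
    using n by (simp add: x_def power2_eq_square)
  finally show ?thesis by (simp add: m_def s_def)
qed

text \<open>The condition on \<open>l\<close> is the growth budget:
  \<open>(2 * n powr (1 / L)) ^ l\<close> equals \<open>exp (l * ln 2 + l / L * ln n)\<close>, which
  is at most \<open>sqrt n\<close> because \<open>ln 2 < 1\<close>. The remaining factor
  \<open>1 / N\<close> is at most \<open>L / n\<close>.\<close>

lemma second_moment_le: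
  fixes L p :: real
  assumes r: "r \<ge> 2" and L: "1 \<le> L" "L \<le> real n" and m: "2 * real (l * (r - 1) + 1) \<le> L"
    and l: "real l + real l / L * ln (real n) \<le> ln (real n) / 2"
    and eq: "(real n / L) powr (real r - 1 + 1 / L) * p = 1" and p: "p \<le> 1"
  shows "measure_pmf.prob (random_hypergraph r n p) {E. \<forall>v. \<not> ordered_loose_path r n E l v} \<le>
    L / sqrt (real n)"
proof -
  define s where "s = r - 1"
  define m where "m = l * s + 1"
  define N where "N = n div m"
  have n: "1 \<le> real n" using L by linarith
  have rs: "real r - 1 = real s" using r by (simp add: s_def)
  have y: "0 < L / real n" "1 \<le> real n / L" "real n / L \<le> real n"
    using L n by (auto simp: field_simps)
  have pe: "p = (L / real n) powr (real s + 1 / L)"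
    using edge_prob_eq_powr[OF _ _ eq] L n rs by simp
  have p0: "0 < p" using y(1) L(1) n unfolding pe by simp
  \<comment> \<open>Rounding down costs less than 1. The factor 2 in the condition on
    \<open>m\<close> gives \<open>n / m \<ge> 2 * (n / L)\<close>, and \<open>n / L \<ge> 1\<close>
    pays for the loss.\<close>
  have N: "real n / L \<le> real N"
  proof -
    have m1: "1 \<le> real m" by (simp add: m_def)
    have mL: "2 * real m \<le> L" using m by (simp add: m_def s_def)
    have "real n / real m - 1 < real N"
      using floor_divide_of_nat_eq[of n m, where ?'a = real] floor_correct[of "real n / real m"]
      by (simp add: N_def)
    moreover have "2 * (real n / L) \<le> real n / real m"
      using m1 mL n by (simp add: field_simps mult_left_mono)
    ultimately show ?thesis using y by linarith
  qed
  have "1 / (p * real N ^ s) \<le> 1 / (p * (real n / L) ^ s)"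
    using p0 y N by (intro divide_left_mono mult_left_mono power_mono mult_pos_pos zero_less_power) auto
  also have "\<dots> = (real n / L) powr (1 / L)"
  proof -
    have "(real n / L) ^ s * (real n / L) powr (1 / L) * p = 1"
      using eq y unfolding rs by (simp add: powr_add powr_realpow)
    then show ?thesis using p0 y by (simp add: field_simps)
  qed
  also have "\<dots> \<le> real n powr (1 / L)"
    using y L by (intro powr_mono2) auto
  \<comment> \<open>The summand 1 is absorbed since \<open>n powr (1 / L) \<ge> 1\<close>.\<close>
  finally have "1 + 1 / (p * real N ^ s) \<le> 2 * real n powr (1 / L)"
    using ge_one_powr_ge_zero[OF n, of "1 / L"] L by simp
  then have "(1 + 1 / (p * real N ^ s)) ^ l \<le> (2 * real n powr (1 / L)) ^ l"
    using p0 by (intro power_mono add_nonneg_nonneg) auto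
  also have "\<dots> = exp (real l * ln 2 + real l / L * ln (real n))"
  proof -
    have "2 ^ l = exp (real l * ln 2)" by (simp add: exp_of_nat_mult)
    then show ?thesis
      using n by (simp add: power_mult_distrib powr_def exp_add exp_of_nat_mult[symmetric])
  qed
  also have "\<dots> \<le> exp (ln (real n) / 2)"
    using l mult_left_mono[of "ln 2" "1 :: real" "real l"] ln_2_less_1 by simp
  also have "\<dots> = sqrt (real n)"
    using n by (simp add: powr_half_sqrt[symmetric] powr_def)
  finally have A: "(1 + 1 / (p * real N ^ s)) ^ l \<le> sqrt (real n)" .
  have "N \<ge> 1" using N y by linarith
  then have "measure_pmf.prob (random_hypergraph r n p) {E. \<forall>v. \<not> ordered_loose_path r n E l v} \<le>
      1 / real N * (1 + 1 / (p * real N ^ s)) ^ l"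
    using prob_no_path_le[OF r p0 p \<open>N \<ge> 1\<close>, of l n] times_div_less_eq_dividend[of m n]
    by (simp only: N_def m_def s_def)
  also have "\<dots> \<le> L / real n * sqrt (real n)"
  proof (intro mult_mono A)
    show "1 / real N \<le> L / real n" using N y L n \<open>N \<ge> 1\<close> by (simp add: field_simps)
  qed (use L n p0 in auto)
  also have "\<dots> = L / sqrt (real n)"
    using n by (simp add: field_simps real_sqrt_mult_self flip: power2_eq_square)
  finally show ?thesis .
qed

section \<open>Existence of \<open>l0\<close>\<close>

text \<open>The intermediate value theorem for \<open>g n\<close> on \<open>[1, C * ln n]\<close>:
  the lower bound on \<open>p\<close> makes \<open>g n 1 > 1\<close>, the upper bound makes the
  value at the right end at most 1. Divergence follows because \<open>g n A > 1\<close> eventually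
  for each fixed \<open>A \<ge> 1\<close>, while \<open>g n\<close> is nonincreasing on
  \<open>[1, n]\<close> for positive \<open>p n\<close>.\<close>

lemma ell0_exists:
  fixes r :: nat and \<omega> p :: "nat \<Rightarrow> real"
  assumes r: "r \<ge> 2"
    and \<omega>: "(\<lambda>n. 1 / \<omega> n) \<longlonglongrightarrow> 0"
    and lower: "\<forall>\<^sub>F n in sequentially. 1 / real n powr (real r - 1 + 1 / \<omega> n) \<le> p n"
    and upper: "p \<in> O(\<lambda>n. ln (real n) ^ (r - 1) / real n ^ (r - 1))"
  shows "\<exists>l0. is_ell0 r p l0"
proof -
  define s where "s = r - 1"
  have s: "s \<ge> 1" "real r - 1 = real s" using r by (auto simp: s_def)
  define g where "g = (\<lambda>n x. (real n / x) powr (real s + 1 / x) * p n)"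
  obtain K0 where "K0 > 0"
    and K0: "\<forall>\<^sub>F n in sequentially. norm (p n) \<le> K0 * norm (ln (real n) ^ s / real n ^ s)"
    using upper by (auto elim: landau_o.bigE simp: s_def)
  define K where "K = max 1 K0"
  \<comment> \<open>At \<open>b = C * ln n\<close> the factor \<open>(n / b) powr (1 / b)\<close> is
    at most \<open>exp (1 / C) \<le> 3\<close>, so
    \<open>g n b \<le> 3 * K / C ^ s = C / C ^ s \<le> 1\<close>.\<close>
  define C where "C = 3 * K"
  have K: "1 \<le> K" "K0 \<le> K" and C: "1 \<le> C" by (auto simp: K_def C_def)
  \<comment> \<open>Inserting the lower bound on \<open>p\<close> leaves
    \<open>n powr (1 / A - 1 / \<omega> n)\<close> times a constant depending on \<open>A\<close>.
    Eventually \<open>1 / \<omega> n < 1 / (2 * A)\<close>, so the exponent stays above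
    \<open>1 / (2 * A)\<close>.\<close>
  have large: "\<forall>\<^sub>F n in sequentially. g n A > 1" if "A \<ge> 1" for A
  proof -
    have "filterlim (\<lambda>n. real n powr e * B) at_top sequentially" if "e > 0" "B > 0" for e B
      using that by real_asymp
    from this[of "1 / (2 * A)" "A powr - (real s + 1 / A)"] that have "\<forall>\<^sub>F n in sequentially. real n powr (1 / (2 * A)) * A powr - (real s + 1 / A) > 1"
      by (simp add: filterlim_at_top_dense)
    moreover have "\<forall>\<^sub>F n in sequentially. 1 / \<omega> n < 1 / (2 * A)"
      using that by (intro order_tendstoD(2)[OF \<omega>]) simp
    ultimately show ?thesis
      using lower eventually_ge_at_top[of 1]
    proof eventually_elim
      case (elim n)
      have "1 < real n powr (1 / (2 * A)) * A powr - (real s + 1 / A)" by fact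
      also have "\<dots> \<le> real n powr (1 / A - 1 / \<omega> n) * A powr - (real s + 1 / A)"
        using elim that by (intro mult_right_mono powr_mono) (auto simp: field_simps)
      also have "\<dots> = (real n / A) powr (real s + 1 / A) * (1 / real n powr (real s + 1 / \<omega> n))"
      proof -
        have "real n powr (1 / A - 1 / \<omega> n) = real n powr (real s + 1 / A) / real n powr (real s + 1 / \<omega> n)"
          by (simp flip: powr_diff)
        then show ?thesis
          unfolding powr_minus_divide using elim that by (simp add: powr_divide)
      qed
      also have "\<dots> \<le> g n A"
        using elim unfolding g_def s by (intro mult_left_mono) auto
      finally show ?case .
    qed
  qed
  have "\<forall>\<^sub>F n in sequentially. \<exists>x. 1 \<le> x \<and> x \<le> C * ln (real n) \<and> g n x = 1"
  proof -
    have "\<forall>\<^sub>F n in sequentially. ln (real n) \<ge> 1" by real_asymp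
    then show ?thesis using large[of 1, OF order.refl] K0 eventually_ge_at_top[of 2]
    proof eventually_elim
      case (elim n)
      define b where "b = C * ln (real n)"
      have n: "real n > 0" using elim by simp
      have "1 * 1 \<le> b" unfolding b_def using C elim by (intro mult_mono) auto
      then have b: "b \<ge> 1" by simp
      have "g n b \<le> 1"
      proof -
        have q: "p n \<le> K * (ln (real n) / real n) ^ s"
        proof -
          have "p n \<le> K0 * (ln (real n) / real n) ^ s"
            using elim by (auto simp: abs_mult power_divide)
          also have "\<dots> \<le> K * (ln (real n) / real n) ^ s"
            using K elim by (intro mult_right_mono) auto
          finally show ?thesis .
        qed
        have "(real n / b) powr (1 / b) \<le> real n powr (1 / b)"
          using b n by (intro powr_mono2) (auto simp: field_simps)
        also have "\<dots> = exp (1 / C)"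
          using n elim by (simp add: powr_def b_def)
        also have "\<dots> \<le> exp 1" using C by simp
        also have "\<dots> \<le> 3" by (rule exp_le)
        finally have e3: "(real n / b) powr (1 / b) \<le> 3" .
        have "g n b = (real n / b) ^ s * (real n / b) powr (1 / b) * p n"
          using b n by (simp add: g_def powr_add powr_realpow)
        also have "\<dots> \<le> (real n / b) ^ s * 3 * (K * (ln (real n) / real n) ^ s)"
        \<comment> \<open>Monotonicity of products needs a nonnegative \<open>p n\<close>; in the
          other case the two sides are separated by 0.\<close>
        proof (cases "p n \<ge> 0")
          case True
          then show ?thesis using b n e3 q by (intro mult_mono) auto
        next
          case False
          then have "(real n / b) ^ s * (real n / b) powr (1 / b) * p n \<le> 0"
            using b n by (intro mult_nonneg_nonpos) auto
          also have "0 \<le> (real n / b) ^ s * 3 * (K * (ln (real n) / real n) ^ s)"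
            using b n K elim by (intro mult_nonneg_nonneg) auto
          finally show ?thesis .
        qed
        also have "\<dots> = C / C ^ s"
          using n elim C by (simp add: b_def C_def power_divide power_mult_distrib)
        also have "\<dots> \<le> 1"
          using self_le_power[of C s] C s by simp
        finally show ?thesis .
      qed
      moreover have "continuous_on {1..b} (g n)"
        unfolding g_def using n by (intro continuous_intros) auto
      ultimately have "\<exists>x\<ge>1. x \<le> b \<and> g n x = 1"
        using elim b by (intro IVT2') auto
      then show ?case by (auto simp: b_def)
    qed
  qed
  then obtain l0 where l0:
    "\<forall>\<^sub>F n in sequentially. 1 \<le> l0 n \<and> l0 n \<le> C * ln (real n) \<and> g n (l0 n) = 1"
    by (auto simp: eventually_ex)
  have "filterlim l0 at_top sequentially"
    unfolding filterlim_at_top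
  proof
    fix Z :: real
    define A where "A = max 1 Z"
    have "1 \<le> A" by (simp add: A_def)
    have "\<forall>\<^sub>F n in sequentially. real n \<ge> A" by real_asymp
    then show "\<forall>\<^sub>F n in sequentially. Z \<le> l0 n"
      using l0 large[OF \<open>1 \<le> A\<close>]
    proof eventually_elim
      case (elim n)
      then have "g n A > 1" by simp
      show ?case
      proof (rule ccontr)
        \<comment> \<open>Then \<open>l0 n \<le> A\<close>, and monotonicity forces
          \<open>g n A \<le> g n (l0 n) = 1\<close>.\<close>
        assume "\<not> Z \<le> l0 n"
        then have A: "1 \<le> l0 n" "l0 n \<le> A" "A \<le> real n" using elim by (auto simp: A_def)
        have "p n > 0" using \<open>g n A > 1\<close> by (simp add: g_def) (smt (verit) mult_nonneg_nonpos powr_ge_zero)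
        have "(real n / A) powr (real s + 1 / A) \<le> (real n / A) powr (real s + 1 / l0 n)"
          using A by (intro powr_mono) (auto simp: field_simps)
        also have "\<dots> \<le> (real n / l0 n) powr (real s + 1 / l0 n)"
          using A by (intro powr_mono2) (auto simp: frac_le)
        finally have "g n A \<le> g n (l0 n)"
          unfolding g_def using \<open>p n > 0\<close> by (intro mult_right_mono) auto
        with elim \<open>g n A > 1\<close> show False by simp
      qed
    qed
  qed
  then have "(\<lambda>n. 1 / l0 n) \<longlonglongrightarrow> 0"
    using tendsto_inverse_0_at_top by (simp add: inverse_eq_divide)
  moreover have "l0 \<in> O(\<lambda>n. ln (real n))"
  proof (rule bigoI)
    show "\<forall>\<^sub>F n in sequentially. norm (l0 n) \<le> C * norm (ln (real n))"
      using l0 by eventually_elim (use C in \<open>auto intro: order_trans mult_left_mono\<close>)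
  qed
  moreover have "\<forall>\<^sub>F n in sequentially. l0 n > 0"
    using l0 by eventually_elim auto
  moreover have "\<forall>\<^sub>F n in sequentially. (real n / l0 n) powr (real r - 1 + 1 / l0 n) * p n = 1"
    using l0 by eventually_elim (simp add: g_def s)
  ultimately show ?thesis unfolding is_ell0_def by blast
qed

section \<open>Two-sided bounds on the maximal length\<close>

text \<open>Outside two bad events there is a path of length \<open>a n\<close>, about
  \<open>c * l0 n\<close>, and none of length \<open>b n\<close>, about \<open>2 * l0 n\<close>.
  With \<open>l0 n \<le> K * ln n\<close>, the moment estimates bound their total probability by
  \<open>err n\<close>, which tends to 0.\<close>

lemma aas_l_max_bounds:
  fixes r :: nat and p l0 :: "nat \<Rightarrow> real"
  assumes r: "r \<ge> 3" and p: "\<And>n. 0 \<le> p n \<and> p n \<le> 1" and l0: "is_ell0 r p l0"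
  shows "\<exists>c C. 0 < c \<and> c \<le> C \<and> aas (\<lambda>n. random_hypergraph r n (p n))
    (\<lambda>n E. c * l0 n \<le> real (l_max r n E) \<and> real (l_max r n E) \<le> C * l0 n)"
proof -
  define s where "s = r - 1"
  have s: "s \<ge> 1" using r by (simp add: s_def)
  have pos: "\<forall>\<^sub>F n in sequentially. l0 n > 0"
    and eq: "\<forall>\<^sub>F n in sequentially. (real n / l0 n) powr (real r - 1 + 1 / l0 n) * p n = 1"
    using l0 by (auto simp: is_ell0_def)
  have "filterlim (\<lambda>n. inverse (1 / l0 n)) at_top sequentially"
    using l0 by (intro filterlim_inverse_at_top) (auto simp: is_ell0_def)
  then have top: "filterlim l0 at_top sequentially" by simp
  obtain K where K: "K > 0" "\<forall>\<^sub>F n in sequentially. norm (l0 n) \<le> K * norm (ln (real n))"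
    using l0 by (auto elim: landau_o.bigE simp: is_ell0_def)
  \<comment> \<open>The factor \<open>8 * s\<close> lets \<open>a n * s + 1\<close> layers fit into
    \<open>L / 2\<close>; the factor \<open>K + 1\<close> makes \<open>a n + a n / L * ln n\<close>
    at most \<open>2 * c * (K + 1) * ln n\<close>, hence at most \<open>ln n / 2\<close>.\<close>
  define c where "c = 1 / (8 * real s * (K + 1))"
  have c: "0 < c" "8 * real s * c \<le> 1" "4 * c * (K + 1) \<le> 1" "c \<le> 2"
  proof -
    have K1: "1 \<le> K + 1" using K by simp
    have s1: "1 \<le> real s" using s by simp
    show "0 < c" using s1 K1 by (simp add: c_def)
    show "8 * real s * c \<le> 1" using s1 K1 by (simp add: c_def)
    show "4 * c * (K + 1) \<le> 1" using s1 K1 by (simp add: c_def)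
    have "1 * 1 \<le> real s * (K + 1)" using s1 K1 by (intro mult_mono) auto
    then show "c \<le> 2" by (simp add: c_def field_simps)
  qed
  define a where "a = (\<lambda>n. nat \<lceil>c * l0 n\<rceil>)"
  define b where "b = (\<lambda>n. nat \<lceil>2 * l0 n\<rceil>)"
  define err where "err = (\<lambda>n. K * ln (real n) / sqrt (real n) + 3 * (K * ln (real n))\<^sup>2 / real n)"
  define good where
    "good = (\<lambda>n E. c * l0 n \<le> real (l_max r n E) \<and> real (l_max r n E) \<le> 2 * l0 n)"
  define P where "P = (\<lambda>n. measure_pmf.prob (random_hypergraph r n (p n)))"
  have "err \<longlonglongrightarrow> 0" unfolding err_def using K(1) by real_asymp
  then have lim: "(\<lambda>n. 1 - err n) \<longlonglongrightarrow> 1"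
    using tendsto_diff[OF tendsto_const, of err 0 sequentially 1] by simp
  have "\<forall>\<^sub>F n in sequentially. ln (real n) \<ge> 1 \<and> real n \<ge> 1 \<and> K * ln (real n) \<le> real n"
    using K(1) by (intro eventually_conj) real_asymp+
  \<comment> \<open>The bound \<open>1 / c\<close> keeps the rounded length \<open>a n\<close> below
    \<open>2 * c * L\<close>, and 4 absorbs the additional layer in the count.\<close>
  moreover have "\<forall>\<^sub>F n in sequentially. l0 n \<ge> max 4 (1 / c)"
    using top unfolding filterlim_at_top by blast
  ultimately have "\<forall>\<^sub>F n in sequentially. 1 - err n \<le> P n {E. good n E}"
    using eq K(2)
  proof eventually_elim
    case (elim n)
    define L where "L = l0 n"
    have n: "ln (real n) \<ge> 1" "real n \<ge> 1" "n \<ge> 1" using elim by auto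
    have L: "L \<ge> 4" "1 \<le> c * L" "L \<le> K * ln (real n)" "L \<le> real n"
      using elim c by (auto simp: L_def field_simps)
    have a: "c * L \<le> real (a n)" "real (a n) \<le> 2 * c * L"
      using L c unfolding a_def L_def by linarith+
    have b: "2 * L \<le> real (b n)" "real (b n) < 2 * L + 1"
      using L unfolding b_def L_def by linarith+
    have "P n {E. \<forall>v. \<not> ordered_loose_path r n E (a n) v} \<le> L / sqrt (real n)"
      unfolding P_def
    proof (rule second_moment_le)
      have "real (a n * s) \<le> 2 * c * L * real s"
        using a by (simp add: mult_right_mono)
      also have "\<dots> \<le> L / 4" using mult_left_mono[OF c(2), of L] L by (simp add: field_simps)
      finally show "2 * real (a n * (r - 1) + 1) \<le> L" using L by (simp add: s_def)
      have "real (a n) / L \<le> 2 * c" using a L by (simp add: field_simps)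
      then have "real (a n) / L * ln (real n) \<le> 2 * c * ln (real n)"
        using n by (intro mult_right_mono) auto
      moreover have "real (a n) \<le> 2 * c * (K * ln (real n))"
        using a L c mult_left_mono[of L "K * ln (real n)" "2 * c"] by linarith
      moreover have "2 * c * ln (real n) + 2 * c * (K * ln (real n)) \<le> ln (real n) / 2"
        using mult_right_mono[OF c(3), of "ln (real n)"] n by (simp add: algebra_simps)
      ultimately show "real (a n) + real (a n) / L * ln (real n) \<le> ln (real n) / 2" by linarith
      show "(real n / L) powr (real r - 1 + 1 / L) * p n = 1" using elim by (simp add: L_def)
    qed (use L r p in auto)
    also have "\<dots> \<le> K * ln (real n) / sqrt (real n)"
      using L by (intro divide_right_mono) auto
    finally have A: "P n {E. \<forall>v. \<not> ordered_loose_path r n E (a n) v} \<le> K * ln (real n) / sqrt (real n)" .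
    have "P n {E. \<exists>v. ordered_loose_path r n E (b n) v} \<le>
        real (n choose (b n * (r - 1) + 1)) * p n ^ b n"
      unfolding P_def using r p by (intro prob_path_le) auto
    also have "\<dots> \<le> 3 * L\<^sup>2 / real n"
      using elim L b r by (intro first_moment_le) (auto simp: L_def)
    also have "\<dots> \<le> 3 * (K * ln (real n))\<^sup>2 / real n"
      using L by (intro divide_right_mono mult_left_mono power_mono) auto
    finally have B: "P n {E. \<exists>v. ordered_loose_path r n E (b n) v} \<le> 3 * (K * ln (real n))\<^sup>2 / real n" .
    have "- {E. good n E} \<subseteq> {E. \<forall>v. \<not> ordered_loose_path r n E (a n) v} \<union>
        {E. \<exists>v. ordered_loose_path r n E (b n) v}"
    proof (rule subsetI, rule ccontr)
      fix E assume E: "E \<in> - {E. good n E}"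
        and "E \<notin> {E. \<forall>v. \<not> ordered_loose_path r n E (a n) v} \<union>
          {E. \<exists>v. ordered_loose_path r n E (b n) v}"
      then obtain v where v: "ordered_loose_path r n E (a n) v"
        and nb: "\<And>v. \<not> ordered_loose_path r n E (b n) v" by blast
      have "a n \<le> l_max r n E" using r by (intro l_max_ge[OF _ v]) simp
      moreover have "l_max r n E < b n" using r n by (intro l_max_less nb) auto
      \<comment> \<open>Integrality compensates for the rounding:
        \<open>l_max + 1 \<le> b n < 2 * L + 1\<close> gives a bound by \<open>2 * L\<close>
        itself.\<close>
      then have "real (l_max r n E) + 1 \<le> real (b n)" by simp
      ultimately have "good n E" using a b unfolding good_def L_def[symmetric] by linarith
      with E show False by simp
    qed
    then have "P n (- {E. good n E}) \<le> P n ({E. \<forall>v. \<not> ordered_loose_path r n E (a n) v} \<union>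
        {E. \<exists>v. ordered_loose_path r n E (b n) v})"
      unfolding P_def by (intro measure_pmf.finite_measure_mono) auto
    also have "\<dots> \<le> P n {E. \<forall>v. \<not> ordered_loose_path r n E (a n) v} +
        P n {E. \<exists>v. ordered_loose_path r n E (b n) v}"
      unfolding P_def by (intro measure_Un_le) auto
    also have "\<dots> \<le> err n" unfolding err_def by (intro add_mono A B)
    also have "P n (- {E. good n E}) = 1 - P n {E. good n E}"
      unfolding P_def using measure_pmf.prob_compl[of "{E. good n E}" "random_hypergraph r n (p n)"]
      by (simp add: Compl_eq_Diff_UNIV)
    finally show ?case by simp
  qed
  then have "(\<lambda>n. P n {E. good n E}) \<longlonglongrightarrow> 1"
    by (rule tendsto_sandwich[OF _ _ lim tendsto_const]) (simp add: P_def)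
  then show ?thesis
    using c unfolding aas_def P_def good_def by (intro exI[of _ c] exI[of _ 2]) auto
qed

theorem theorem1p6:
  fixes r :: nat and \<omega> p :: "nat \<Rightarrow> real"
  assumes "r \<ge> 3"
    and "\<forall>\<^sub>F n in sequentially. \<omega> n > 0"
    and "(\<lambda>n. 1 / \<omega> n) \<longlonglongrightarrow> 0"
    and "(\<lambda>n. \<omega> n / ln (real n)) \<longlonglongrightarrow> 0"
    and "\<And>n. 0 \<le> p n \<and> p n \<le> 1"
    and "\<forall>\<^sub>F n in sequentially. 1 / real n powr (real r - 1 + 1 / \<omega> n) \<le> p n"
    and "p \<in> O(\<lambda>n. ln (real n) ^ (r - 1) / real n ^ (r - 1))"
  shows "(\<exists>l0. is_ell0 r p l0) \<and>
    (\<forall>l0. is_ell0 r p l0 \<longrightarrow>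
      (\<exists>c C. 0 < c \<and> c \<le> C \<and>
        aas (\<lambda>n. random_hypergraph r n (p n))
          (\<lambda>n E. c * l0 n \<le> real (l_max r n E) \<and> real (l_max r n E) \<le> C * l0 n)))"
  using ell0_exists[of r \<omega> p] aas_l_max_bounds[of r p] assms by auto

end
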